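(* Let $b\geq 2$ and let $c,\hat c\geq 0$ be integers lying in a common oasis base $b$ (i.e., for every integer $t$ between $c$ and $\hat c$ inclusive, $S_{[t,b]}$ has a fixed point). Let $a,\hat a\in\mathbb{Z}^+$ satisfy $S_{[c,b]}(a)=a$ and $S_{[\hat c,b]}(\hat a)=\hat a$. Writing $a=\sum_{i\ge 0} a_i b^i$ and $\hat a=\sum_{i\ge0}\hat a_i b^i$ with $0\le a_i,\hat a_i\le b-1$ (base $b$ expansions, with $a_i=0$, $\hat a_i=0$ for all sufficiently large $i$), we have $a_i=\hat a_i$ for every $i\geq 3$.
   Context: For integers $c\geq 0$ and $b\geq 2$, the augmented generalized happy function $S_{[c,b]}:\mathbb{Z}^+\to\mathbb{Z}^+$ is defined by $S_{[c,b]}\left(\sum_{i=0}^n a_i b^i\right)=c+\sum_{i=0}^n a_i^2$, where $0\le a_i\le b-1$, $a_n\neq 0$ (the base $b$ expansion). A positive integer $a$ is a fixed point of $S_{[c,b]}$ if $S_{[c,b]}(a)=a$. An oasis base $b$ is a set of consecutive non-negative integers $c$ such that for each of them $S_{[c,b]}$ has at least one fixed point. *)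

theory Defs
  imports Main
begin

text \<open>
  The digit sequence of a base expansion is a function on all of \<open>nat\<close>, padded with zeros
  above the leading digit.
\<close>

definition is_base_expansion :: "nat \<Rightarrow> nat \<Rightarrow> (nat \<Rightarrow> nat) \<Rightarrow> bool" where
  "is_base_expansion b a d \<longleftrightarrow>
     (\<forall>i. d i \<le> b - 1) \<and> finite {i. d i \<noteq> 0} \<and> a = (\<Sum>i | d i \<noteq> 0. d i * b ^ i)"

definition digit :: "nat \<Rightarrow> nat \<Rightarrow> nat \<Rightarrow> nat" where
  "digit b a i = a div b ^ i mod b"

text \<open>
  For \<open>b \<ge> 2\<close> and \<open>a > 0\<close> the index set \<open>{i. b ^ i \<le> a}\<close> is \<open>{0..n}\<close>, where \<open>n\<close> is the
  position of the leading base \<open>b\<close> digit of \<open>a\<close>. The value at \<open>a = 0\<close> is irrelevant.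
\<close>

definition happy :: "nat \<Rightarrow> nat \<Rightarrow> nat \<Rightarrow> nat" where
  "happy c b a = c + (\<Sum>i | b ^ i \<le> a. (digit b a i)\<^sup>2)"

definition fixed_point :: "nat \<Rightarrow> nat \<Rightarrow> nat \<Rightarrow> bool" where
  "fixed_point c b a \<longleftrightarrow> a > 0 \<and> happy c b a = a"

definition oasis :: "nat \<Rightarrow> nat set \<Rightarrow> bool" where
  "oasis b C \<longleftrightarrow>
     (\<forall>x\<in>C. \<forall>y\<in>C. {x..y} \<subseteq> C) \<and> (\<forall>c\<in>C. \<exists>a. fixed_point c b a)"

lemma digit_of_expansion:
  fixes b :: nat
  assumes "b \<ge> 2" and "\<And>i. d i \<le> b - 1"
  shows "digit b (\<Sum>i<n. d i * b ^ i) j = (if j < n then d j else 0)"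
  using assms(2)
proof (induction j arbitrary: d n)
  case 0
  show ?case
  proof (cases n)
    case (Suc m)
    have "(\<Sum>i<Suc m. d i * b ^ i) = d 0 + b * (\<Sum>i<m. d (Suc i) * b ^ i)"
      by (simp add: sum.lessThan_Suc_shift sum_distrib_left mult_ac del: sum.lessThan_Suc)
    moreover have "d 0 < b" using "0"[of 0] assms(1) by linarith
    ultimately show ?thesis using Suc by (simp add: digit_def del: sum.lessThan_Suc)
  qed (simp add: digit_def)
next
  case (Suc j)
  show ?case
  proof (cases n)
    case n: (Suc m)
    have eq: "(\<Sum>i<Suc m. d i * b ^ i) = d 0 + b * (\<Sum>i<m. d (Suc i) * b ^ i)"
      by (simp add: sum.lessThan_Suc_shift sum_distrib_left mult_ac del: sum.lessThan_Suc)
    have "d 0 < b" using Suc.prems[of 0] assms(1) by linarith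
    then have "(\<Sum>i<Suc m. d i * b ^ i) div b = (\<Sum>i<m. d (Suc i) * b ^ i)"
      unfolding eq by simp
    then show ?thesis
      using Suc.IH[of "\<lambda>i. d (Suc i)" m] Suc.prems n
      by (simp add: digit_def div_mult2_eq del: sum.lessThan_Suc)
  qed (simp add: digit_def)
qed

lemma expansion_digits:
  assumes "b \<ge> 2" and "is_base_expansion b a d"
  shows "d = digit b a"
proof
  fix j
  from assms(2) have le: "\<And>i. d i \<le> b - 1" and fin: "finite {i. d i \<noteq> 0}"
    and a: "a = (\<Sum>i | d i \<noteq> 0. d i * b ^ i)"
    by (auto simp: is_base_expansion_def)
  obtain n where n: "{i. d i \<noteq> 0} \<subseteq> {..<n}"
    using finite_nat_set_iff_bounded[of "{i. d i \<noteq> 0}"] fin by auto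
  have "a = (\<Sum>i<n. d i * b ^ i)"
    unfolding a by (rule sum.mono_neutral_left) (use n in auto)
  then show "d j = digit b a j"
    using digit_of_expansion[OF assms(1) le, where n = n and j = j] n by auto
qed

lemma happy_expansion:
  assumes "b \<ge> 2" and "is_base_expansion b a d"
  shows "happy c b a = c + (\<Sum>i | d i \<noteq> 0. (d i)\<^sup>2)"
proof -
  have d: "d = digit b a" by (rule expansion_digits[OF assms])
  have sub: "{i. d i \<noteq> 0} \<subseteq> {i. b ^ i \<le> a}"
    unfolding d digit_def by (auto intro: leI)
  have "{i. b ^ i \<le> a} \<subseteq> {..a}"
  proof
    fix i assume "i \<in> {i. b ^ i \<le> a}"
    moreover have "i < 2 ^ i" by (rule less_exp)
    moreover have "(2::nat) ^ i \<le> b ^ i" using assms(1) by (rule power_mono) simp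
    ultimately show "i \<in> {..a}" by (simp only: mem_Collect_eq atMost_iff)
  qed
  then have "finite {i. b ^ i \<le> a}" using finite_subset by blast
  then have "(\<Sum>i | d i \<noteq> 0. (d i)\<^sup>2) = (\<Sum>i | b ^ i \<le> a. (d i)\<^sup>2)"
    by (rule sum.mono_neutral_left) (use sub in auto)
  then show ?thesis by (simp add: happy_def d)
qed

end

theory Submission
  imports Defs
begin

text \<open>
  Let \<open>s n\<close> be the sum of the squared base \<open>b\<close> digits of \<open>n\<close>, that is \<open>happy 0 b n\<close>. A fixed
  point \<open>a\<close> for \<open>c\<close> satisfies \<open>c = a - s a\<close>. With \<open>n = a div b\<^sup>3\<close> and \<open>g n = b\<^sup>3 n - s n\<close>, the three
  low digits contribute to \<open>c - g n\<close> an amount between \<open>-(b - 1)(b - 2)\<close> and \<open>b\<^sup>3 - b\<^sup>2\<close>. On the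
  other hand \<open>g (n + 1) - g n \<ge> b\<^sup>3 - 2 b + 3\<close>, so the integer \<open>g n + b\<^sup>3 - b\<^sup>2 + 1\<close> lies strictly
  between the values of \<open>c\<close> coming from quotients \<open>\<le> n\<close> and those coming from quotients \<open>> n\<close>.
  It belongs to no oasis, so all fixed points of an oasis have the same quotient by \<open>b\<^sup>3\<close>.
\<close>

lemma happy_0_rec:
  assumes "b \<ge> 2"
  shows "happy 0 b a = (a mod b)\<^sup>2 + happy 0 b (a div b)"
proof (cases "a = 0")
  case True
  then show ?thesis by (simp add: happy_def digit_def)
next
  case False
  have fin: "finite {i. b ^ i \<le> m}" for m
  proof (rule finite_subset)
    show "{i. b ^ i \<le> m} \<subseteq> {..m}"
    proof
      fix i assume "i \<in> {i. b ^ i \<le> m}"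
      then have "b ^ i \<le> m" by simp
      moreover have "i < 2 ^ i" by (rule less_exp)
      moreover have "(2::nat) ^ i \<le> b ^ i" using assms by (rule power_mono) simp
      ultimately have "i \<le> m" by linarith
      then show "i \<in> {..m}" by simp
    qed
  qed simp
  have idx: "{i. b ^ i \<le> a} = insert 0 (Suc ` {i. b ^ i \<le> a div b})"
  proof (intro set_eqI)
    fix i show "i \<in> {i. b ^ i \<le> a} \<longleftrightarrow> i \<in> insert 0 (Suc ` {i. b ^ i \<le> a div b})"
      using False assms by (cases i) (auto simp: less_eq_div_iff_mult_less_eq mult.commute)
  qed
  show ?thesis
    unfolding happy_def idx
    by (simp add: fin sum.reindex digit_def div_mult2_eq)
qed

text \<open>Without a carry the last digit \<open>x\<close> is at most \<open>b - 2\<close>, and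
  raising it adds \<open>2 * x + 1\<close>, at most \<open>2 * b - 3\<close>. With a carry the last
  digit falls to 0 and induction applies to the quotient.\<close>

lemma happy_0_Suc_le:
  assumes "b \<ge> 2"
  shows "happy 0 b (Suc n) + 3 \<le> happy 0 b n + 2 * b"
proof (induction n rule: less_induct)
  case (less n)
  show ?case
  proof (cases "Suc (n mod b) = b")
    case True
    then have eq: "Suc n mod b = 0" "Suc n div b = Suc (n div b)"
      by (simp_all add: mod_Suc div_Suc)
    from True assms have "n div b < n" by (cases "n = 0") auto
    from less.IH[OF this] show ?thesis
      by (subst (1 2) happy_0_rec[OF assms]) (simp add: eq)
  next
    case False
    then have eq: "Suc n mod b = Suc (n mod b)" "Suc n div b = n div b"
      by (simp_all add: mod_Suc div_Suc)
    have "n mod b < b" using assms by simp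
    with False have "n mod b + 2 \<le> b" by linarith
    then show ?thesis
      by (subst (1 2) happy_0_rec[OF assms]) (simp add: eq power2_eq_square)
  qed
qed

text \<open>The function \<open>g\<close> of the overview, over \<open>int\<close> to avoid
  truncated subtraction.\<close>

definition high_part :: "nat \<Rightarrow> nat \<Rightarrow> int" where
  "high_part b n = int b ^ 3 * int n - int (happy 0 b n)"

lemma high_part_Suc:
  assumes "b \<ge> 2"
  shows "high_part b n + int b ^ 3 - 2 * int b + 3 \<le> high_part b (Suc n)"
  using happy_0_Suc_le[OF assms, of n] by (simp add: high_part_def algebra_simps)

lemma fixed_point_bounds:
  assumes "b \<ge> 2" and "fixed_point c b a"
  shows "high_part b (a div b ^ 3) - (int b - 1) * (int b - 2) \<le> int c"
    and "int c \<le> high_part b (a div b ^ 3) + int b ^ 3 - int b ^ 2"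
proof -
  define x y z n where xyzn: "x = int (a mod b)" "y = int (a div b mod b)"
    "z = int (a div b div b mod b)" "n = a div b div b div b"
  have n: "n = a div b ^ 3"
    by (simp add: xyzn div_mult2_eq power3_eq_cube)
  have a: "int a = x + int b * (y + int b * (z + int b * int n))"
    unfolding xyzn by (simp flip: of_nat_mult of_nat_add)
  have s: "int (happy 0 b a) = x\<^sup>2 + y\<^sup>2 + z\<^sup>2 + int (happy 0 b n)"
    unfolding xyzn
    by (subst happy_0_rec[OF assms(1)], subst happy_0_rec[OF assms(1)],
        subst happy_0_rec[OF assms(1)]) simp
  have "a = c + happy 0 b a"
    using assms(2) by (simp add: fixed_point_def happy_def)
  then have "int c = int a - int (happy 0 b a)" by linarith
  then have c: "int c = high_part b n + (x - x\<^sup>2) + y * (int b - y) + z * ((int b)\<^sup>2 - z)"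
    unfolding a s high_part_def by (simp add: algebra_simps power2_eq_square power3_eq_cube)
  have rng: "0 \<le> x" "x \<le> int b - 1" "0 \<le> y" "y \<le> int b - 1" "0 \<le> z" "z \<le> int b - 1"
    using assms(1) by (simp_all add: xyzn Suc_leI flip: of_nat_less_iff add: zmod_int)
  have b: "int b \<ge> 2" using assms(1) by simp
  have "x * (x - 1) \<le> (int b - 1) * (int b - 2)"
    using rng b by (cases "x = 0") (auto intro!: mult_mono)
  moreover have "0 \<le> x * (x - 1)" using rng by (cases "x = 0") auto
  ultimately have x: "- ((int b - 1) * (int b - 2)) \<le> x - x\<^sup>2" "x - x\<^sup>2 \<le> 0"
    by (simp_all add: algebra_simps power2_eq_square)
  have y0: "0 \<le> y * (int b - y)" using rng by simp
  \<comment> \<open>A crude bound on each factor suffices: added to the maximum of the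
    \<open>z\<close> term it gives exactly \<open>b ^ 3 - b ^ 2\<close>.\<close>
  have y: "y * (int b - y) \<le> (int b - 1) * (int b - 1)"
    using rng b by (cases "y = 0") (auto intro!: mult_mono)
  have bb: "2 * int b \<le> (int b)\<^sup>2" using b unfolding power2_eq_square by (intro mult_right_mono) auto
  have z0: "0 \<le> z * ((int b)\<^sup>2 - z)" using rng b bb by (intro mult_nonneg_nonneg) linarith+
  \<comment> \<open>This product is the value of the \<open>z\<close> term at \<open>b - 1\<close>
    minus its value at \<open>z\<close>.\<close>
  have "0 \<le> (int b - 1 - z) * ((int b)\<^sup>2 - z - (int b - 1))"
    using rng bb by (intro mult_nonneg_nonneg) linarith+
  then have z: "z * ((int b)\<^sup>2 - z) \<le> (int b - 1) * ((int b)\<^sup>2 - (int b - 1))"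
    by (simp add: algebra_simps)
  show "high_part b (a div b ^ 3) - (int b - 1) * (int b - 2) \<le> int c"
    using c x y0 z0 unfolding n by linarith
  have "(int b - 1) * (int b - 1) + (int b - 1) * ((int b)\<^sup>2 - (int b - 1)) = int b ^ 3 - int b ^ 2"
    by (simp add: algebra_simps power2_eq_square power3_eq_cube)
  then show "int c \<le> high_part b (a div b ^ 3) + int b ^ 3 - int b ^ 2"
    using c x y z unfolding n by linarith
qed

lemma oasis_quotient_le:
  assumes b: "b \<ge> 2" and C: "oasis b C" "c \<in> C" "c' \<in> C"
    and fp: "fixed_point c b a" "fixed_point c' b a'"
  shows "a' div b ^ 3 \<le> a div b ^ 3"
proof (rule ccontr)
  define n where "n = a div b ^ 3"
  \<comment> \<open>One more than the upper bound for quotient \<open>n\<close>; as \<open>c\<close>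
    obeys that bound, \<open>nat\<close> truncates nothing.\<close>
  define t where "t = nat (high_part b n + int b ^ 3 - int b ^ 2 + 1)"
  assume "\<not> a' div b ^ 3 \<le> a div b ^ 3"
  then have n': "Suc n \<le> a' div b ^ 3" by (simp add: n_def)
  have mono: "mono (high_part b)"
  proof (rule monoI, rule lift_Suc_mono_le[of "high_part b"])
    fix k
    have "2 * int b * 1 \<le> int b * int b * int b"
      using b by (intro mult_mono) auto
    then show "high_part b k \<le> high_part b (Suc k)"
      using high_part_Suc[OF b, of k] by (simp add: power3_eq_cube)
  qed
  \<comment> \<open>The bounds leave a margin of \<open>b\<close>: they give
    \<open>t + b \<le> e\<close>.\<close>
  have above: "int t < int e" if "fixed_point e b m" "Suc n \<le> m div b ^ 3" "int t =
    high_part b n + int b ^ 3 - int b ^ 2 + 1" for e m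
  proof -
    have "high_part b (Suc n) \<le> high_part b (m div b ^ 3)"
      using mono that(2) by (rule monoD)
    moreover have "(int b - 1) * (int b - 2) = int b ^ 2 - 3 * int b + 2"
      by (simp add: algebra_simps power2_eq_square)
    ultimately show ?thesis
      using high_part_Suc[OF b, of n] fixed_point_bounds(1)[OF b that(1)] that(3) b by linarith
  qed
  have c: "int c \<le> high_part b n + int b ^ 3 - int b ^ 2"
    using fixed_point_bounds(2)[OF b fp(1)] by (simp add: n_def)
  then have t: "int t = high_part b n + int b ^ 3 - int b ^ 2 + 1"
    by (simp add: t_def)
  have "t \<in> {c..c'}" using c t above[OF fp(2) n' t] by simp
  then have "t \<in> C" using C unfolding oasis_def by blast
  then obtain m where m: "fixed_point t b m" using C(1) unfolding oasis_def by blast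
  \<comment> \<open>A larger quotient would give \<open>t < t\<close>; a quotient up to
    \<open>n\<close> keeps \<open>t\<close> under the bound it exceeds by one.\<close>
  have "m div b ^ 3 \<le> n" using above[OF m _ t] by (meson less_irrefl not_less_eq_eq)
  then have "high_part b (m div b ^ 3) \<le> high_part b n"
    by (rule monoD[OF mono])
  then show False using fixed_point_bounds(2)[OF b m] t by linarith
qed

theorem theorem6:
  fixes b c c' a a' :: nat and C :: "nat set" and d d' :: "nat \<Rightarrow> nat"
  assumes "b \<ge> 2"
    and "oasis b C" and "c \<in> C" and "c' \<in> C"
    and "fixed_point c b a" and "fixed_point c' b a'"
    and "is_base_expansion b a d" and "is_base_expansion b a' d'"
  shows "\<forall>i\<ge>3. d i = d' i"
proof (intro allI impI)
  fix i :: nat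
  assume "i \<ge> 3"
  \<comment> \<open>Digits from position 3 on depend only on the quotient by
    \<open>b ^ 3\<close>.\<close>
  then have "b ^ i = b ^ 3 * b ^ (i - 3)" by (simp flip: power_add)
  moreover have "a div b ^ 3 = a' div b ^ 3"
    using assms by (intro antisym oasis_quotient_le)
  ultimately show "d i = d' i"
    using expansion_digits[OF assms(1,7)] expansion_digits[OF assms(1,8)]
    by (simp add: digit_def div_mult2_eq)
qed

end
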